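(* Let $\alpha>0$, $\alpha\ne1$. Consider a $k$-parameter $\mathcal{B}^{(\alpha)}$-family $\{f_\lambda:\lambda\in\Lambda\}$, characterized by $w=[w_1,\dots,w_d]^T$, $h$, $f=[f_1,\dots,f_d]^T$, $\Lambda$ and $S$, with common support $S\subset\mathbb{R}$, and let $\mathcal{L}_{\mathcal{B}}^{(\alpha)}$ be the underlying generalized likelihood function. Suppose that the range of $w(\lambda)$, $\lambda\in\Lambda$, contains a $d$-dimensional rectangle. Let $\overline{f}^{d}=[\overline{f_1},\dots,\overline{f_d}]^T$, where $\overline{f_i}=\frac1n\sum_{j=1}^n f_i(Y_j)$. Then, for any real-valued function $g$ for which $\widetilde E_\lambda[g(\overline f^d)]$ exists for all $\lambda\in\Lambda$, $g(\overline{f}^{d})$ is the generalized UMVUE for $\widetilde\tau(\lambda)=\widetilde E_\lambda\left[g(\overline f^{d})\right]$.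
   Context: $\mathcal{B}^{(\alpha)}$-family: a family $\{f_\lambda:\lambda\in\Lambda\}$ of probability densities, $\Lambda\subseteq\mathbb{R}^k$ open, such that $$f_\lambda(y)=\left[h(y)+Z(\lambda)+w(\lambda)^Tf(y)\right]^{\frac1{\alpha-1}}\ \text{ for }y\in S,\qquad f_\lambda(y)=0\ \text{ otherwise},$$ where $S\subseteq\mathbb{R}$ is the support of $f_\lambda$ (the same for all $\lambda$), $w=[w_1,\dots,w_d]^T$ with each $w_i:\Lambda\to\mathbb{R}$ differentiable, $f=[f_1,\dots,f_d]^T$ with $f_i:\mathbb{R}\to\mathbb{R}$, $h:\mathbb{R}\to\mathbb{R}$, and $Z:\Lambda\to\mathbb{R}$ is the normalizing factor. $Y_1^n=(Y_1,\dots,Y_n)$ is an i.i.d. sample from some $f_\lambda$. The generalized likelihood function (associated with the density power divergence) is $$\mathcal{L}_{\mathcal{B}}^{(\alpha)}(y_1^n;\lambda)=\frac1n\sum_{j=1}^n\left[\frac{\alpha f_\lambda^{\alpha-1}(y_j)-1}{\alpha-1}\right]-\int f_\lambda^\alpha(y)\,dy,\qquad y_1^n\in S^n.$$ The deformed distribution is $\widetilde f_\lambda(y_1^n)=\exp[\mathcal{L}_{\mathcal{B}}^{(\alpha)}(y_1^n;\lambda)]\big/\int_{S^n}\exp[\mathcal{L}_{\mathcal{B}}^{(\alpha)}(r_1^n;\lambda)]\,dr_1^n$ on $S^n$, the denominator being assumed finite; $\widetilde P_\lambda,\widetilde E_\lambda,\widetilde{Var}_\lambda$ are probability, expectation and variance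 under $\widetilde f_\lambda$. An estimator $\hat\lambda(Y_1^n)$ is a generalized unbiased estimator of $\widetilde{\tau}(\lambda)$ if $\widetilde{E}_\lambda[\hat\lambda(Y_1^n)]=\widetilde{\tau}(\lambda)$ for all $\lambda\in\Lambda$. A generalized unbiased estimator $\hat\lambda$ of $\widetilde\tau(\lambda)$ is a generalized UMVUE (uniformly minimum variance unbiased estimator) if $\widetilde{Var}_\lambda(\hat\lambda)\le\widetilde{Var}_\lambda(\lambda^* )$ for all $\lambda\in\Lambda$ and every generalized unbiased estimator $\lambda^*$ of $\widetilde\tau(\lambda)$. *)

theory Defs
  imports "HOL-Probability.Probability"
begin

definition is_probability_density :: "(real \<Rightarrow> real) \<Rightarrow> bool" where
  "is_probability_density p \<longleftrightarrow>
     p \<in> borel_measurable borel \<and> (\<forall>y. 0 \<le> p y) \<and> (\<integral>\<^sup>+ y. ennreal (p y) \<partial>lborel) = 1"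

text \<open>Both usual conventions for the support of a density are admitted: the set where it does not
  vanish, and the closure of that set.\<close>

definition is_support :: "real set \<Rightarrow> (real \<Rightarrow> real) \<Rightarrow> bool" where
  "is_support S p \<longleftrightarrow> S \<in> sets borel \<and> {y. p y \<noteq> 0} \<subseteq> S \<and> S \<subseteq> closure {y. p y \<noteq> 0}"

text \<open>The real power \<open>b powr (1 / (\<alpha> - 1))\<close> carries its usual meaning only for \<open>b > 0\<close>, or for
  \<open>b = 0\<close> and a positive exponent, i.e. \<open>\<alpha> > 1\<close>; this is demanded of the base on \<open>S\<close>.
  The condition on \<open>Z\<close>, to be the normalizing factor, is that \<open>p \<theta>\<close> is a probability density.\<close>

definition B_alpha_family ::
  "real \<Rightarrow> (real^'k) set \<Rightarrow> real set \<Rightarrow> (real \<Rightarrow> real) \<Rightarrow> (real^'k \<Rightarrow> real) \<Rightarrow>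
   (real^'k \<Rightarrow> real^'d) \<Rightarrow> (real \<Rightarrow> real^'d) \<Rightarrow> (real^'k \<Rightarrow> real \<Rightarrow> real) \<Rightarrow> bool" where
  "B_alpha_family \<alpha> \<Lambda> S h Z w f p \<longleftrightarrow>
     open \<Lambda> \<and>
     (\<forall>i. (\<lambda>\<theta>. w \<theta> $ i) differentiable_on \<Lambda>) \<and>
     (\<forall>\<theta>\<in>\<Lambda>.
        is_probability_density (p \<theta>) \<and>
        is_support S (p \<theta>) \<and>
        (\<forall>y\<in>S. let b = h y + Z \<theta> + w \<theta> \<bullet> f y in
                 (0 < b \<or> b = 0 \<and> 1 < \<alpha>) \<and> p \<theta> y = b powr (1 / (\<alpha> - 1))) \<and>
        (\<forall>y. y \<notin> S \<longrightarrow> p \<theta> y = 0))"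

text \<open>A sample of size \<open>n = CARD('n)\<close> is a vector in \<open>real^'n\<close>.\<close>

definition gen_likelihood :: "real \<Rightarrow> (real \<Rightarrow> real) \<Rightarrow> real^'n \<Rightarrow> real" where
  "gen_likelihood \<alpha> q y =
     (1 / real CARD('n)) * (\<Sum>j\<in>UNIV. (\<alpha> * q (y $ j) powr (\<alpha> - 1) - 1) / (\<alpha> - 1))
     - (LBINT t. q t powr \<alpha>)"

text \<open>Lebesgue measure on \<open>S\<^sup>n\<close>. Its space is \<open>S\<^sup>n\<close> and not all of \<open>real^'n\<close>, so that statistics need
  only be measurable on \<open>S\<^sup>n\<close>.\<close>

definition lebesgue_power :: "real set \<Rightarrow> (real^'n) measure" where
  "lebesgue_power S = restrict_space lborel {y. \<forall>j. y $ j \<in> S}"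

definition deformed_density :: "real \<Rightarrow> real set \<Rightarrow> (real \<Rightarrow> real) \<Rightarrow> real^'n \<Rightarrow> real" where
  "deformed_density \<alpha> S q y =
     exp (gen_likelihood \<alpha> q y) / (LINT r|lebesgue_power S. exp (gen_likelihood \<alpha> q (r :: real^'n)))"

definition deformed_distribution :: "real \<Rightarrow> real set \<Rightarrow> (real \<Rightarrow> real) \<Rightarrow> (real^'n) measure" where
  "deformed_distribution \<alpha> S q =
     density (lebesgue_power S) (\<lambda>y. ennreal (deformed_density \<alpha> S q y))"

definition deformed_expectation ::
  "real \<Rightarrow> real set \<Rightarrow> (real \<Rightarrow> real) \<Rightarrow> (real^'n \<Rightarrow> real) \<Rightarrow> real" where
  "deformed_expectation \<alpha> S q T = (LINT y|deformed_distribution \<alpha> S q. T y)"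

text \<open>The variance takes values in \<open>[0, \<infinity>]\<close>: an unbiased estimator need not be square-integrable, and
  the real-valued Bochner integral would assign it variance \<open>0\<close>.\<close>

definition deformed_variance ::
  "real \<Rightarrow> real set \<Rightarrow> (real \<Rightarrow> real) \<Rightarrow> (real^'n \<Rightarrow> real) \<Rightarrow> ennreal" where
  "deformed_variance \<alpha> S q T =
     (\<integral>\<^sup>+ y. ennreal ((T y - deformed_expectation \<alpha> S q T)\<^sup>2) \<partial>deformed_distribution \<alpha> S q)"

definition gen_unbiased ::
  "real \<Rightarrow> (real^'k) set \<Rightarrow> real set \<Rightarrow> (real^'k \<Rightarrow> real \<Rightarrow> real) \<Rightarrow>
   (real^'k \<Rightarrow> real) \<Rightarrow> (real^'n \<Rightarrow> real) \<Rightarrow> bool" where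
  "gen_unbiased \<alpha> \<Lambda> S p \<tau> T \<longleftrightarrow>
     (\<forall>\<theta>\<in>\<Lambda>. integrable (deformed_distribution \<alpha> S (p \<theta>)) T \<and>
             deformed_expectation \<alpha> S (p \<theta>) T = \<tau> \<theta>)"

definition gen_UMVUE ::
  "real \<Rightarrow> (real^'k) set \<Rightarrow> real set \<Rightarrow> (real^'k \<Rightarrow> real \<Rightarrow> real) \<Rightarrow>
   (real^'k \<Rightarrow> real) \<Rightarrow> (real^'n \<Rightarrow> real) \<Rightarrow> bool" where
  "gen_UMVUE \<alpha> \<Lambda> S p \<tau> T \<longleftrightarrow>
     gen_unbiased \<alpha> \<Lambda> S p \<tau> T \<and>
     (\<forall>T' :: real^'n \<Rightarrow> real. gen_unbiased \<alpha> \<Lambda> S p \<tau> T' \<longrightarrow>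
        (\<forall>\<theta>\<in>\<Lambda>. deformed_variance \<alpha> S (p \<theta>) T \<le> deformed_variance \<alpha> S (p \<theta>) T'))"

definition sample_mean :: "(real \<Rightarrow> real^'d) \<Rightarrow> real^'n \<Rightarrow> real^'d" where
  "sample_mean f y = (\<chi> i. (1 / real CARD('n)) * (\<Sum>j\<in>UNIV. f (y $ j) $ i))"

end

theory Submission
  imports Defs "HOL-Complex_Analysis.Conformal_Mappings"
begin

text \<open>On the support \<open>p \<theta> y powr (\<alpha> - 1) = h y + Z \<theta> + w \<theta> \<bullet> f y\<close>, so the deformed density is an exponential
  family with natural parameter \<open>\<alpha> / (\<alpha> - 1) * w \<theta>\<close> and sufficient statistic the sample mean of \<open>f\<close>. The
  difference \<open>D\<close> of two unbiased estimators then has a Laplace transform, taken along the sample mean,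
  that vanishes on an open cube; hence \<open>D\<close> is orthogonal to every bounded function of the sample mean.
  Expanding \<open>(U + D)\<^sup>2\<close>, with \<open>U\<close> the centred statistic, truncated to make the mixed term integrable,
  gives the variance inequality without conditional expectations.

  The function \<open>g\<close> need not be Borel: only its composition with the sample mean is measurable. Inner
  regularity, applied on the graph of the sample mean, extends the orthogonality from Borel
  preimages to all measurable sets that are unions of fibres.\<close>

section \<open>Vanishing Laplace transforms\<close>

text \<open>Around \<open>z0\<close> the factor \<open>exp ((z - z0) * X x)\<close> is expanded in
  powers of \<open>z - z0\<close> and integrated termwise. Two real exponentials with parameters
  still in \<open>(-e, e)\<close> dominate, so the transform is locally a power series.\<close>

lemma holomorphic_on_laplace_transform:
  fixes X D :: "'a \<Rightarrow> real"
  assumes [measurable]: "X \<in> borel_measurable M" "D \<in> borel_measurable M"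
    and int: "\<And>s. \<bar>s\<bar> < e \<Longrightarrow> integrable M (\<lambda>x. exp (s * X x) * D x)"
  shows "(\<lambda>z. LINT x|M. exp (z * of_real (X x)) * of_real (D x)) holomorphic_on {z :: complex. \<bar>Re z\<bar> < e}"
    (is "?F holomorphic_on ?S")
proof -
  have "?F field_differentiable at z0 within ?S" if z0: "z0 \<in> ?S" for z0
  proof -
    \<comment> \<open>Horizontal distance from \<open>z0\<close> to the edge of the strip:
      \<open>norm u < r\<close> keeps \<open>Re z0 + norm u\<close> and
      \<open>Re z0 - norm u\<close> inside it.\<close>
    define r where "r = e - \<bar>Re z0\<bar>"
    have r: "r > 0" using z0 by (simp add: r_def)
    define a where "a k = (LINT x|M. exp (z0 * of_real (X x)) * of_real (D x) * of_real (X x) ^ k / fact k)" for k :: nat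
    have sums: "(\<lambda>k. a k * (z - z0) ^ k) sums ?F z" if z: "z \<in> ball z0 r" for z
    proof -
      define u where "u = z - z0"
      define t where "t k x = exp (z0 * of_real (X x)) * of_real (D x) * of_real (X x) ^ k / fact k * u ^ k" for k x
      \<comment> \<open>As \<open>exp (norm u * \<bar>X x\<bar>)\<close> is at most the sum of the
        exponentials with either sign, this one integrable function bounds all partial sums of
        norms.\<close>
      define G where "G x = norm (exp ((Re z0 + norm u) * X x) * D x) + norm (exp ((Re z0 - norm u) * X x) * D x)" for x
      have u: "norm u < r" using z by (simp add: u_def dist_norm norm_minus_commute)
      have "\<bar>Re z0 + norm u\<bar> < e" "\<bar>Re z0 - norm u\<bar> < e"
        using u norm_ge_zero[of u] unfolding r_def by linarith+
      then have G: "integrable M G"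
        unfolding G_def by (intro Bochner_Integration.integrable_add integrable_norm int)
      have [measurable]: "t k \<in> borel_measurable M" for k
        unfolding t_def by measurable
      have nt: "norm (t k x) = exp (Re z0 * X x) * \<bar>D x\<bar> * ((norm u * \<bar>X x\<bar>) ^ k / fact k)" for k x
        by (simp add: t_def norm_mult norm_divide norm_power power_mult_distrib)
      have snt: "(\<lambda>k. norm (t k x)) sums (exp (Re z0 * X x) * \<bar>D x\<bar> * exp (norm u * \<bar>X x\<bar>))" for x
        unfolding nt using exp_converges[of "norm u * \<bar>X x\<bar>"]
        by (intro sums_mult) (simp add: divide_inverse mult.commute)
      have le: "exp (Re z0 * X x) * \<bar>D x\<bar> * exp (norm u * \<bar>X x\<bar>) \<le> G x" for x
        by (cases "X x \<ge> 0") (auto simp: G_def abs_mult algebra_simps simp flip: exp_add)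
      have partial: "(\<Sum>k<n. norm (t k x)) \<le> G x" for n x
        using sum_le_suminf[of "\<lambda>k. norm (t k x)" "{..<n}"] snt[of x] le[of x]
        by (auto simp: sums_iff)
      have "norm (t k x) \<le> norm (G x)" for k x
        using partial[of x "Suc k"] sum_nonneg[of "{..<k}" "\<lambda>k. norm (t k x)"] by simp
      then have intt: "integrable M (t k)" for k
        by (intro Bochner_Integration.integrable_bound[OF G]) auto
      have "(\<lambda>k. integral\<^sup>L M (t k)) sums (LINT x|M. (\<Sum>k. t k x))"
      proof (rule sums_integral[OF intt])
        show "AE x in M. summable (\<lambda>k. norm (t k x))"
          using snt by (auto simp: sums_iff)
        show "summable (\<lambda>k. LINT x|M. norm (t k x))"
        proof (rule summableI_nonneg_bounded[where x="integral\<^sup>L M G"])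
          fix n
          have "(\<Sum>k<n. LINT x|M. norm (t k x)) = (LINT x|M. (\<Sum>k<n. norm (t k x)))"
            using intt by (subst Bochner_Integration.integral_sum) auto
          also have "\<dots> \<le> integral\<^sup>L M G"
            using intt G partial by (intro integral_mono) auto
          finally show "(\<Sum>k<n. LINT x|M. norm (t k x)) \<le> integral\<^sup>L M G" .
        qed simp
      qed
      moreover have "(\<Sum>k. t k x) = exp (z * of_real (X x)) * of_real (D x)" for x
      proof -
        have "(\<lambda>k. exp (z0 * of_real (X x)) * of_real (D x) * ((u * of_real (X x)) ^ k /\<^sub>R fact k)) sums
            (exp (z0 * of_real (X x)) * of_real (D x) * exp (u * of_real (X x)))"
          by (intro sums_mult exp_converges)
        moreover have "exp (z0 * of_real (X x)) * exp (u * of_real (X x)) = exp (z * of_real (X x))"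
          by (simp add: u_def algebra_simps flip: exp_add)
        ultimately show ?thesis
          unfolding t_def
          by (simp add: sums_iff scaleR_conv_of_real power_mult_distrib field_simps)
      qed
      moreover have "integral\<^sup>L M (t k) = a k * u ^ k" for k
        unfolding t_def a_def by simp
      ultimately show ?thesis by (simp add: u_def)
    qed
    have "?F holomorphic_on ball z0 r"
      by (rule power_series_holomorphic[OF sums])
    then have "?F field_differentiable at z0"
      by (rule holomorphic_on_imp_differentiable_at) (use r in simp_all)
    then show ?thesis by (rule field_differentiable_at_within)
  qed
  then show ?thesis by (simp add: holomorphic_on_def)
qed

text \<open>Since \<open>ennreal\<close> sends negative reals to \<open>0\<close>, the two densities
  are the positive and negative parts of the signed measure with density \<open>D\<close>. Both
  parts are finite, so their masses can be subtracted.\<close>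

lemma distr_pos_neg_part_eqI:
  fixes D :: "'a \<Rightarrow> real"
  assumes D: "integrable M D" and X[measurable]: "X \<in> M \<rightarrow>\<^sub>M N" and C: "C \<in> sets N"
  shows "emeasure (distr (density M (\<lambda>x. ennreal (D x))) N X) C = emeasure (distr (density M (\<lambda>x. ennreal (- D x))) N X) C
    \<longleftrightarrow> (LINT x|M. indicator C (X x) * D x) = 0"
proof -
  note [measurable] = C borel_measurable_integrable[OF D]
  have X': "X \<in> density M h \<rightarrow>\<^sub>M N" for h by simp
  have em: "emeasure (distr (density M (\<lambda>x. ennreal (c * D x))) N X) C = (\<integral>\<^sup>+x. ennreal (c * (indicator C (X x) * D x)) \<partial>M)" for c :: real
    using C by (subst emeasure_distr[OF X'])
      (auto simp: emeasure_density measurable_sets[OF X] indicator_def intro!: nn_integral_cong)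
  have iD: "integrable M (\<lambda>x. indicator C (X x) * D x)"
    by (rule Bochner_Integration.integrable_bound[OF D]) (auto simp: indicator_def)
  have fin: "(\<integral>\<^sup>+x. ennreal (c * (indicator C (X x) * D x)) \<partial>M) < \<infinity>" for c :: real
    using integrable_mult_right[of c, OF iD] unfolding real_integrable_def by (auto simp: less_top)
  have *: "enn2real a - enn2real b = 0 \<longleftrightarrow> a = b" if "a < \<infinity>" "b < \<infinity>" for a b
    using that by (cases a; cases b) auto
  show ?thesis
    using em[of 1] em[of "-1"] *[OF fin[of 1] fin[of "-1"]]
    by (simp add: real_lebesgue_integral_def[OF iD])
qed

text \<open>Links the two image measures to integrals against \<open>D\<close>; applied to complex
  exponentials, for characteristic functions, and to the identity.\<close>

lemma integral_distr_pos_neg_part_diff: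
  fixes D :: "'a \<Rightarrow> real" and \<phi> :: "'b \<Rightarrow> 'c::{banach, second_countable_topology}"
  assumes [measurable]: "D \<in> borel_measurable M" "X \<in> M \<rightarrow>\<^sub>M N" "\<phi> \<in> borel_measurable N"
    and int: "integrable M (\<lambda>x. D x *\<^sub>R \<phi> (X x))"
  shows "integral\<^sup>L (distr (density M (\<lambda>x. ennreal (D x))) N X) \<phi>
       - integral\<^sup>L (distr (density M (\<lambda>x. ennreal (- D x))) N X) \<phi>
       = (LINT x|M. D x *\<^sub>R \<phi> (X x))"
proof -
  have part: "integral\<^sup>L (distr (density M (\<lambda>x. ennreal (c * D x))) N X) \<phi> = (LINT x|M. max 0 (c * D x) *\<^sub>R \<phi> (X x))" for c :: real
  proof -
    have d: "density M (\<lambda>x. ennreal (c * D x)) = density M (\<lambda>x. ennreal (max 0 (c * D x)))"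
      by (intro arg_cong2[where f=density] ext) (auto simp: max_def ennreal_neg)
    show ?thesis
      unfolding d by (subst integral_distr, simp, simp, subst integral_density) simp_all
  qed
  have intp: "integrable M (\<lambda>x. max 0 (c * D x) *\<^sub>R \<phi> (X x))" for c :: real
    by (rule Bochner_Integration.integrable_bound[OF integrable_scaleR_right[OF int, of c]])
       (auto simp: abs_mult[symmetric] intro!: mult_right_mono)
  show ?thesis
    using part[of 1] part[of "-1"] intp[of 1] intp[of "-1"]
    by (simp add: Bochner_Integration.integral_diff[symmetric] del: Bochner_Integration.integral_diff)
       (intro Bochner_Integration.integral_cong; auto simp: max_def simp flip: scaleR_left.diff)
qed

text \<open>The transform is holomorphic on a strip and vanishes on a real segment, hence on the
  imaginary axis by the identity theorem. There it is, up to scaling, the difference of the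
  characteristic functions of the images of the two parts of \<open>D\<close>, which therefore
  coincide by Levy's uniqueness theorem.\<close>

lemma integral_eq_0_if_vanishing_laplace_transform_real:
  fixes X D :: "'a \<Rightarrow> real"
  assumes X[measurable]: "X \<in> borel_measurable M" and "0 < e"
    and int: "\<And>s. \<bar>s\<bar> < e \<Longrightarrow> integrable M (\<lambda>x. exp (s * X x) * D x)"
    and zero: "\<And>s. \<bar>s\<bar> < e \<Longrightarrow> (LINT x|M. exp (s * X x) * D x) = 0"
    and C[measurable]: "C \<in> sets borel"
  shows "(LINT x|M. indicator C (X x) * D x) = 0"
proof -
  have D: "integrable M D" and D0: "integral\<^sup>L M D = 0"
    using int[of 0] zero[of 0] \<open>0 < e\<close> by simp_all
  note [measurable] = borel_measurable_integrable[OF D]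
  define F where "F z = (LINT x|M. exp (z * of_real (X x)) * of_real (D x))" for z :: complex
  define S where "S = {z :: complex. \<bar>Re z\<bar> < e}"
  have S: "S = {z. Re z < e} \<inter> {z. Re z > -e}"
    by (auto simp: S_def)
  have F0: "F z = 0" if "z \<in> S" for z
  proof (rule analytic_continuation[where f=F and S=S and U="complex_of_real ` {-e<..<e}" and \<xi>=0])
    show "F holomorphic_on S"
      unfolding F_def S_def by (rule holomorphic_on_laplace_transform) (auto intro: int)
    show "open S" unfolding S by (intro open_Int open_halfspace_Re_lt open_halfspace_Re_gt)
    show "connected S" unfolding S
      by (intro convex_connected convex_Int convex_halfspace_Re_lt convex_halfspace_Re_gt)
    show "complex_of_real ` {-e<..<e} \<subseteq> S" by (auto simp: S_def)
    show "(0::complex) \<in> S" using \<open>0 < e\<close> by (simp add: S_def)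
    \<comment> \<open>The identity theorem needs the zeros to accumulate inside the strip; the real
      segment does so at \<open>0\<close>.\<close>
    show "(0::complex) islimpt complex_of_real ` {-e<..<e}"
      unfolding islimpt_approachable
    proof (intro allI impI)
      fix r :: real assume "0 < r"
      then show "\<exists>z\<in>complex_of_real ` {-e<..<e}. z \<noteq> 0 \<and> dist z 0 < r"
        using \<open>0 < e\<close> by (intro bexI[of _ "complex_of_real (min r e / 2)"] imageI) auto
    qed
    show "F z = 0" if "z \<in> complex_of_real ` {-e<..<e}" for z
    proof -
      obtain s where s: "z = of_real s" "\<bar>s\<bar> < e" using \<open>z \<in> _\<close> by auto
      have "F z = (LINT x|M. complex_of_real (exp (s * X x) * D x))"
        by (simp add: F_def s exp_of_real[symmetric])
      also have "\<dots> = 0" using zero[OF s(2)] by (simp only: integral_complex_of_real) simp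
      finally show ?thesis .
    qed
  qed (fact that)
  \<comment> \<open>Levy's theorem concerns probability measures, so both parts of \<open>D\<close>
    are divided by their mass. The masses agree because the transform vanishes at \<open>0\<close>;
    if they are \<open>0\<close>, then \<open>D\<close> is \<open>0\<close> almost
    everywhere.\<close>
  define m where "m = (LINT x|M. max 0 (D x))"
  have Dp: "integrable M (\<lambda>x. max 0 (D x))" and Dn: "integrable M (\<lambda>x. max 0 (- D x))"
    using D by (auto intro: Bochner_Integration.integrable_max)
  have m': "m = (LINT x|M. max 0 (- D x))"
  proof -
    have "m - (LINT x|M. max 0 (- D x)) = (LINT x|M. max 0 (D x) - max 0 (- D x))"
      using Dp Dn by (simp add: m_def)
    also have "\<dots> = integral\<^sup>L M D"
      by (intro Bochner_Integration.integral_cong) auto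
    finally show ?thesis using D0 by simp
  qed
  show ?thesis
  proof (cases "m = 0")
    case True
    have "AE x in M. max 0 (D x) = 0" "AE x in M. max 0 (- D x) = 0"
      using integral_nonneg_eq_0_iff_AE[OF Dp] integral_nonneg_eq_0_iff_AE[OF Dn] True
      by (auto simp flip: m_def m')
    then have "AE x in M. indicator C (X x) * D x = 0"
      by eventually_elim (auto simp: max_def split: if_splits)
    then show ?thesis by (rule integral_eq_zero_AE)
  next
    case False
    moreover have "m \<ge> 0" unfolding m_def by (intro integral_nonneg_AE) auto
    ultimately have m: "m > 0" by simp
    define E where "E x = D x / m" for x
    have E: "integrable M E" unfolding E_def using D by simp
    note [measurable] = borel_measurable_integrable[OF E]
    have mx: "max 0 (E x) = max 0 (D x) / m" "max 0 (- E x) = max 0 (- D x) / m" for x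
      using m by (auto simp: E_def max_def field_simps)
    define N where "N c = distr (density M (\<lambda>x. ennreal (c * E x))) borel X" for c :: real
    have prob: "real_distribution (N c)" if c: "c \<in> {1, -1}" for c
    proof -
      have "(\<integral>\<^sup>+x. ennreal (c * E x) \<partial>M) = (\<integral>\<^sup>+x. ennreal (max 0 (c * E x)) \<partial>M)"
        by (intro nn_integral_cong) (auto simp: max_def ennreal_neg)
      also have "\<dots> = ennreal (LINT x|M. max 0 (c * E x))"
        using c E by (intro nn_integral_eq_integral) (auto intro: Bochner_Integration.integrable_max)
      also have "(LINT x|M. max 0 (c * E x)) = 1"
        using c m m' by (auto simp: mx m_def[symmetric])
      finally have "prob_space (density M (\<lambda>x. ennreal (c * E x)))"
        by (intro prob_spaceI) (simp add: emeasure_density cong: nn_integral_cong)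
      then show ?thesis
        unfolding N_def by (intro prob_space.real_distribution_distr) (simp_all add: X)
    qed
    have "char (N 1) t = char (N (-1)) t" for t
    proof -
      have i: "integrable M (\<lambda>x. E x *\<^sub>R iexp (t * X x))"
        by (rule Bochner_Integration.integrable_bound[OF E]) auto
      have "char (N 1) t - char (N (-1)) t = (LINT x|M. E x *\<^sub>R iexp (t * X x))"
        unfolding char_def N_def
        using integral_distr_pos_neg_part_diff[of E M X borel "\<lambda>x. iexp (t * x)"] i by simp
      also have "\<dots> = F (\<i> * of_real t) / of_real m"
        unfolding F_def E_def integral_divide_zero[symmetric]
        by (intro Bochner_Integration.integral_cong) (auto simp: scaleR_conv_of_real mult_ac)
      also have "F (\<i> * of_real t) = 0"
        using \<open>0 < e\<close> by (intro F0) (simp add: S_def)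
      finally show ?thesis by simp
    qed
    then have "N 1 = N (-1)"
      by (intro Levy_uniqueness prob) auto
    then have "(LINT x|M. indicator C (X x) * E x) = 0"
      by (subst distr_pos_neg_part_eqI[OF E X C, symmetric]) (simp add: N_def)
    then show ?thesis using m by (simp add: E_def)
  qed
qed

text \<open>The one-dimensional result, used once per coordinate, gives zero on open boxes. These
  are stable under intersection and generate the Borel sets, so the images of the two finite parts
  of \<open>D\<close> under \<open>T\<close> coincide.\<close>

lemma integral_eq_0_if_vanishing_laplace_transform:
  fixes T :: "'a \<Rightarrow> real^'d" and D :: "'a \<Rightarrow> real"
  assumes T[measurable]: "T \<in> borel_measurable M" and "0 < e"
    and int: "\<And>\<eta>. (\<And>i. \<bar>\<eta> $ i\<bar> < e) \<Longrightarrow> integrable M (\<lambda>x. exp (\<eta> \<bullet> T x) * D x)"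
    and zero: "\<And>\<eta>. (\<And>i. \<bar>\<eta> $ i\<bar> < e) \<Longrightarrow> (LINT x|M. exp (\<eta> \<bullet> T x) * D x) = 0"
    and C: "C \<in> sets borel"
  shows "(LINT x|M. indicator C (T x) * D x) = 0"
proof -
  have D: "integrable M D"
    using int[of 0] \<open>0 < e\<close> by simp
  note [measurable] = borel_measurable_integrable[OF D]
  have Ti[measurable]: "(\<lambda>x. T x $ i) \<in> borel_measurable M" for i
    using measurable_compose[OF T borel_measurable_nth[of i]] by simp
  \<comment> \<open>Interpolates between hypothesis and goal: \<open>I = {}\<close> is the
    exponential weight of the hypotheses, \<open>I = UNIV\<close> a product of indicators, as for a
    box.\<close>
  define g where "g I B \<eta> x = (\<Prod>i\<in>I. indicator (B i) (T x $ i)) * exp (\<Sum>i\<in>-I. \<eta> i * T x $ i) * D x"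
    for I and B :: "'d \<Rightarrow> real set" and \<eta> :: "'d \<Rightarrow> real" and x
  \<comment> \<open>Trading exponentials for indicators one coordinate at a time needs only the one-dimensional case.\<close>
  have boxes: "integrable M (g I B \<eta>) \<and> integral\<^sup>L M (g I B \<eta>) = 0"
    if "\<And>i. \<bar>\<eta> i\<bar> < e" "\<And>i. B i \<in> sets borel" for I B \<eta>
    using finite[of I] that
  proof (induction I arbitrary: \<eta> rule: finite_induct)
    case empty
    have "(\<Sum>i\<in>UNIV. \<eta> i * T x $ i) = (\<chi> i. \<eta> i) \<bullet> T x" for x
      by (simp add: inner_vec_def)
    with int[of "\<chi> i. \<eta> i"] zero[of "\<chi> i. \<eta> i"] empty show ?case
      by (simp add: g_def[abs_def])
  next
    case (insert j I)
    \<comment> \<open>What remains of \<open>g\<close> without coordinate \<open>j\<close>. It is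
      the weight for the one-dimensional lemma, the parameter of coordinate \<open>j\<close> being
      free in \<open>(-e, e)\<close>.\<close>
    define D' where "D' x = (\<Prod>i\<in>I. indicator (B i) (T x $ i)) * exp (\<Sum>i\<in>-insert j I. \<eta> i * T x $ i) * D x" for x
    have g1: "g I B (\<eta>(j := s)) = (\<lambda>x. exp (s * T x $ j) * D' x)" for s
    proof
      fix x
      have I: "- I = insert j (- insert j I)" using insert by auto
      have "(\<Sum>i\<in>-I. (\<eta>(j := s)) i * T x $ i) = s * T x $ j + (\<Sum>i\<in>-insert j I. (\<eta>(j := s)) i * T x $ i)"
        by (subst I, subst sum.insert) auto
      also have "(\<Sum>i\<in>-insert j I. (\<eta>(j := s)) i * T x $ i) = (\<Sum>i\<in>-insert j I. \<eta> i * T x $ i)"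
        by (intro sum.cong) auto
      finally show "g I B (\<eta>(j := s)) x = exp (s * T x $ j) * D' x"
        by (simp add: g_def D'_def exp_add mult_ac)
    qed
    have g2: "g (insert j I) B \<eta> = (\<lambda>x. indicator (B j) (T x $ j) * D' x)"
      using insert.hyps by (auto simp: g_def D'_def mult_ac)
    have IH: "integrable M (\<lambda>x. exp (s * T x $ j) * D' x) \<and> (LINT x|M. exp (s * T x $ j) * D' x) = 0"
      if "\<bar>s\<bar> < e" for s
      using insert.IH[of "\<eta>(j := s)"] insert.prems that unfolding g1 by auto
    have D': "integrable M D'" using IH[of 0] \<open>0 < e\<close> by simp
    have [measurable]: "B j \<in> sets borel" by (rule insert.prems)
    have "integrable M (\<lambda>x. indicator (B j) (T x $ j) * D' x)"
      by (rule Bochner_Integration.integrable_bound[OF D'])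
         (use borel_measurable_integrable[OF D'] in \<open>auto simp: indicator_def\<close>)
    moreover have "(LINT x|M. indicator (B j) (T x $ j) * D' x) = 0"
      by (rule integral_eq_0_if_vanishing_laplace_transform_real[OF Ti \<open>0 < e\<close>]) (use IH in auto)
    ultimately show ?case unfolding g2 by simp
  qed
  have "(LINT x|M. indicator (box a b) (T x) * D x) = 0" for a b
  proof -
    have "indicator (box a b) t = (\<Prod>i\<in>UNIV. indicator {a $ i<..<b $ i} (t $ i) :: real)" for t
      by (auto simp: indicator_def mem_box_cart prod_eq_1_iff intro!: prod_zero[symmetric] split: if_splits)
    then show ?thesis
      using boxes[of "\<lambda>_. 0" "\<lambda>i. {a $ i<..<b $ i}" UNIV] \<open>0 < e\<close>
      by (simp add: g_def[abs_def])
  qed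
  note boxes = this
  have fin: "emeasure (distr (density M (\<lambda>x. ennreal (D x))) borel T) A \<noteq> \<infinity>" for A
  proof -
    have "emeasure (distr (density M (\<lambda>x. ennreal (D x))) borel T) A \<le> emeasure (distr (density M (\<lambda>x. ennreal (D x))) borel T) UNIV"
      by (intro emeasure_mono) auto
    also have "\<dots> = (\<integral>\<^sup>+x. ennreal (D x) \<partial>M)"
      by (simp add: emeasure_distr emeasure_density cong: nn_integral_cong)
    also have "\<dots> < \<infinity>" using D by (auto simp: real_integrable_def less_top)
    finally show ?thesis by simp
  qed
  have "distr (density M (\<lambda>x. ennreal (D x))) borel T = distr (density M (\<lambda>x. ennreal (- D x))) borel T"
  proof (rule measure_eqI_generator_eq)
    let ?E = "range (\<lambda>(a, b). box a b :: (real^'d) set)"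
    let ?A = "\<lambda>n::nat. box (- (real n *\<^sub>R One)) (real n *\<^sub>R One) :: (real^'d) set"
    show "Int_stable ?E"
      by (auto simp: Int_stable_def box_Int_box)
    show "?E \<subseteq> Pow UNIV" "sets (distr (density M (\<lambda>x. ennreal (D x))) borel T) = sigma_sets UNIV ?E"
        "sets (distr (density M (\<lambda>x. ennreal (- D x))) borel T) = sigma_sets UNIV ?E"
      by (simp_all add: borel_eq_box)
    show "range ?A \<subseteq> ?E" "(\<Union>i. ?A i) = UNIV"
      unfolding UN_box_eq_UNIV by auto
    show "emeasure (distr (density M (\<lambda>x. ennreal (D x))) borel T) X
        = emeasure (distr (density M (\<lambda>x. ennreal (- D x))) borel T) X" if "X \<in> ?E" for X
      using that boxes by (subst distr_pos_neg_part_eqI[OF D T]) auto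
  qed (rule fin)
  then show ?thesis
    by (subst distr_pos_neg_part_eqI[OF D T C, symmetric]) simp
qed

section \<open>Measurable functions of a statistic\<close>

text \<open>A compact subset of the graph of \<open>T\<close> over the saturated set projects to a compact, hence Borel, set
  of values of \<open>T\<close>, on which the two image measures agree.\<close>

lemma emeasure_saturated_mono:
  fixes T :: "'b::{second_countable_topology, complete_space} \<Rightarrow> 'c::{second_countable_topology, complete_space}"
  assumes sets: "sets N1 = sets (restrict_space borel X)" "sets N2 = sets (restrict_space borel X)"
    and X: "X \<in> sets borel" and "finite_measure N1"
    and T: "T \<in> restrict_space borel X \<rightarrow>\<^sub>M borel"
    and eq: "distr N1 borel T = distr N2 borel T"
    and A: "{x \<in> X. P (T x)} \<in> sets borel" (is "?A \<in> _")
  shows "emeasure N1 ?A \<le> emeasure N2 ?A"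
proof -
  interpret finite_measure N1 by fact
  have T1: "T \<in> N1 \<rightarrow>\<^sub>M borel" and T2: "T \<in> N2 \<rightarrow>\<^sub>M borel"
    using T by (simp_all cong: measurable_cong_sets add: sets)
  have sp: "space N1 = X" "space N2 = X"
    using sets[THEN sets_eq_imp_space_eq] by (simp_all add: space_restrict_space)
  have "(\<lambda>y. y) \<in> N1 \<rightarrow>\<^sub>M borel"
    by (simp cong: measurable_cong_sets add: sets measurable_restrict_space1)
  then have gr: "(\<lambda>y. (y, T y)) \<in> N1 \<rightarrow>\<^sub>M borel"
    using T1 by (simp add: borel_prod[symmetric])
  have A2: "?A \<in> sets N2"
    using A by (auto simp: sets sets_restrict_space intro!: image_eqI[of _ _ ?A])
  \<comment> \<open>\<open>T\<close> is measurable on \<open>X\<close> only; a constant value off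
    the Borel set \<open>X\<close> makes it Borel everywhere, so that its graph over
    \<open>?A\<close> is a Borel set.\<close>
  define T' where "T' y = (if y \<in> X then T y else undefined)" for y
  have [measurable]: "T' \<in> borel_measurable borel"
    unfolding T'_def using T X by (subst measurable_restrict_space_iff[symmetric]) auto
  define G where "G = {p. fst p \<in> ?A \<and> T' (fst p) = snd p}"
  have "G = {p \<in> space (borel \<Otimes>\<^sub>M borel). fst p \<in> ?A} \<inter> {p \<in> space (borel \<Otimes>\<^sub>M borel). T' (fst p) = snd p}"
    by (auto simp: G_def space_pair_measure)
  also have "\<dots> \<in> sets (borel \<Otimes>\<^sub>M borel)"
  proof (rule sets.Int)
    show "{p \<in> space (borel \<Otimes>\<^sub>M borel). fst p \<in> ?A} \<in> sets (borel \<Otimes>\<^sub>M borel)"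
      using measurable_sets[OF measurable_fst A, of borel] by (simp add: vimage_def Int_def conj_commute)
    show "{p \<in> space (borel \<Otimes>\<^sub>M borel). T' (fst p) = snd p} \<in> sets (borel \<Otimes>\<^sub>M borel)"
      by measurable
  qed
  finally have G: "G \<in> sets borel" unfolding borel_prod .
  let ?Q = "distr N1 borel (\<lambda>y. (y, T y))"
  have "emeasure N1 ?A = emeasure ?Q G"
    by (subst emeasure_distr[OF gr G]) (auto simp: G_def T'_def sp intro!: arg_cong[where f="emeasure N1"])
  \<comment> \<open>The graph is what makes regularity useful: \<open>T\<close> may map a compact
    subset of \<open>?A\<close> to a set that is not Borel, but a compact subset of the graph has a
    compact projection.\<close>
  also have "\<dots> = (SUP K\<in>{K. K \<subseteq> G \<and> compact K}. emeasure ?Q K)"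
    using G finite_measure.emeasure_finite[OF finite_measure_distr[OF gr]]
    by (intro inner_regular) auto
  also have "\<dots> \<le> emeasure N2 ?A"
  proof (rule SUP_least)
    fix K assume "K \<in> {K. K \<subseteq> G \<and> compact K}"
    then have K: "K \<subseteq> G" "compact K" by auto
    have snd: "snd ` K \<in> sets borel"
      by (intro borel_closed compact_imp_closed compact_continuous_image K continuous_on_snd continuous_on_id)
    have "emeasure ?Q K = emeasure N1 ((\<lambda>y. (y, T y)) -` K \<inter> space N1)"
      using K by (intro emeasure_distr gr borel_closed compact_imp_closed)
    also have "\<dots> \<le> emeasure N1 (T -` (snd ` K) \<inter> space N1)"
      using T1 snd by (intro emeasure_mono measurable_sets) force+
    also have "\<dots> = emeasure N2 (T -` (snd ` K) \<inter> space N2)"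
      by (simp add: emeasure_distr[OF T1 snd, symmetric] emeasure_distr[OF T2 snd, symmetric] eq)
    also have "\<dots> \<le> emeasure N2 ?A"
    \<comment> \<open>Saturation: \<open>y\<close> shares its value of \<open>T\<close> with a point
      of \<open>?A\<close>, and membership in \<open>?A\<close> depends on that value only.\<close>
    proof (intro emeasure_mono A2 subsetI)
      fix y assume "y \<in> T -` (snd ` K) \<inter> space N2"
      then obtain z where "y \<in> X" "(z, T y) \<in> K" by (auto simp: sp)
      moreover from this K have "z \<in> ?A" "T z = T y" by (auto simp: G_def T'_def)
      ultimately show "y \<in> ?A" by simp
    qed
    finally show "emeasure ?Q K \<le> emeasure N2 ?A" .
  qed
  finally show ?thesis .
qed

text \<open>Preimages under \<open>V\<close> are unions of fibres of \<open>T\<close>, whether or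
  not \<open>G\<close> is measurable. The saturation inequality, used in both directions, shows that
  the two parts of \<open>D\<close> have the same image under \<open>V\<close>; integrating the
  identity against these images gives the claim.\<close>

lemma integral_mult_factor_eq_0:
  fixes T :: "'b::{second_countable_topology, complete_space} \<Rightarrow> 'c::{second_countable_topology, complete_space}"
    and D V :: "'b \<Rightarrow> real"
  assumes sets: "sets M = sets (restrict_space borel X)" and X: "X \<in> sets borel"
    and T: "T \<in> restrict_space borel X \<rightarrow>\<^sub>M borel"
    and D: "integrable M D"
    and zero: "\<And>C. C \<in> sets borel \<Longrightarrow> (LINT x|M. indicator C (T x) * D x) = 0"
    and V[measurable]: "V \<in> borel_measurable M" and factor: "\<And>x. x \<in> X \<Longrightarrow> V x = G (T x)"
    and int: "integrable M (\<lambda>x. V x * D x)"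
  shows "(LINT x|M. V x * D x) = 0"
proof -
  note [measurable] = borel_measurable_integrable[OF D]
  define N where "N c = density M (\<lambda>x. ennreal (c * D x))" for c :: real
  have setsN: "sets (N c) = sets (restrict_space borel X)" for c
    by (simp add: N_def sets)
  have TM: "T \<in> M \<rightarrow>\<^sub>M borel"
    using T by (simp cong: measurable_cong_sets add: sets)
  have sp: "space M = X"
    using sets[THEN sets_eq_imp_space_eq] by (simp add: space_restrict_space)
  have finN: "finite_measure (N c)" for c
  proof
    have "integrable M (\<lambda>x. c * D x)" using D by simp
    then have "(\<integral>\<^sup>+x. ennreal (c * D x) \<partial>M) \<noteq> \<infinity>"
      unfolding real_integrable_def by blast
    then show "emeasure (N c) (space (N c)) \<noteq> \<infinity>"
      by (simp add: N_def emeasure_density cong: nn_integral_cong)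
  qed
  have eqT: "distr (N 1) borel T = distr (N (-1)) borel T"
  proof (rule measure_eqI)
    fix C assume "C \<in> sets (distr (N 1) borel T)"
    then have "C \<in> sets borel" by simp
    then show "emeasure (distr (N 1) borel T) C = emeasure (distr (N (-1)) borel T) C"
      using distr_pos_neg_part_eqI[OF D TM] zero by (simp add: N_def)
  qed simp
  have "distr (N 1) borel V = distr (N (-1)) borel V"
  proof (rule measure_eqI)
    fix C assume "C \<in> sets (distr (N 1) borel V)"
    then have C: "C \<in> sets borel" by simp
    have VN: "V \<in> borel_measurable (N c)" for c
      using V by (simp add: N_def)
    have A: "V -` C \<inter> X = {x \<in> X. G (T x) \<in> C}"
      using factor by auto
    have "V -` C \<inter> X \<in> sets M"
      using measurable_sets[OF V C] by (simp add: sp)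
    then have Am: "{x \<in> X. G (T x) \<in> C} \<in> sets borel"
      using X unfolding A sets by (auto simp: sets_restrict_space)
    have "emeasure (distr (N c) borel V) C = emeasure (N c) {x \<in> X. G (T x) \<in> C}" for c
      by (subst emeasure_distr[OF VN C]) (simp add: A[symmetric] N_def sp)
    moreover have "emeasure (N 1) {x \<in> X. G (T x) \<in> C} = emeasure (N (-1)) {x \<in> X. G (T x) \<in> C}"
      by (intro antisym emeasure_saturated_mono[OF setsN setsN X finN T _ Am] eqT eqT[symmetric])
    ultimately show "emeasure (distr (N 1) borel V) C = emeasure (distr (N (-1)) borel V) C"
      by simp
  qed simp
  then have eqV: "distr (density M (\<lambda>x. ennreal (D x))) borel V = distr (density M (\<lambda>x. ennreal (- D x))) borel V"
    by (simp add: N_def)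
  have "(LINT x|M. D x *\<^sub>R V x) = 0"
    using int by (subst integral_distr_pos_neg_part_diff[where N=borel and \<phi>="\<lambda>x. x", symmetric])
      (simp_all add: eqV mult.commute[of "D _"])
  then show ?thesis by (simp add: mult.commute)
qed

section \<open>The variance inequality by truncation\<close>

lemma nn_integral_square_le_square_add:
  fixes U D :: "'a \<Rightarrow> real"
  assumes U[measurable]: "U \<in> borel_measurable M" and D: "integrable M D"
    and orth: "\<And>m::nat. (LINT x|M. (if \<bar>U x\<bar> \<le> m then U x else 0) * D x) = 0"
  shows "(\<integral>\<^sup>+x. ennreal ((U x)\<^sup>2) \<partial>M) \<le> (\<integral>\<^sup>+x. ennreal ((U x + D x)\<^sup>2) \<partial>M)"
proof (cases "(\<integral>\<^sup>+x. ennreal ((U x + D x)\<^sup>2) \<partial>M) = \<infinity>")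
  case False
  note [measurable] = borel_measurable_integrable[OF D]
  \<comment> \<open>Truncation gives
    \<open>\<bar>W m x * D x\<bar> \<le> m * \<bar>D x\<bar>\<close>, so the mixed term is
    integrable although neither \<open>U\<close> nor \<open>D\<close> is assumed
    square-integrable.\<close>
  define W where "W m x = (if \<bar>U x\<bar> \<le> real m then U x else 0)" for m x
  have [measurable]: "W m \<in> borel_measurable M" for m
    unfolding W_def by measurable
  have sq: "integrable M (\<lambda>x. (U x + D x)\<^sup>2)"
    using False by (intro integrableI_nonneg) (auto simp: less_top)
  have WD: "integrable M (\<lambda>x. W m x * D x)" for m
    by (rule Bochner_Integration.integrable_bound[OF integrable_mult_right[of "real m", OF D]])
       (auto simp: W_def abs_mult intro!: mult_right_mono)
  \<comment> \<open>Where \<open>U\<close> is kept, the two sides differ by the square of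
    \<open>D x\<close>; where it is cut off, the left side and the mixed term are
    \<open>0\<close>.\<close>
  have le: "(W m x)\<^sup>2 \<le> (U x + D x)\<^sup>2 - 2 * (W m x * D x)" for m x
    using zero_le_power2[of "U x + D x"] zero_le_power2[of "D x"]
    by (auto simp: W_def power2_eq_square algebra_simps)
  have "(\<integral>\<^sup>+x. ennreal ((W m x)\<^sup>2) \<partial>M) \<le> (\<integral>\<^sup>+x. ennreal ((U x + D x)\<^sup>2) \<partial>M)" for m
  proof -
    have "(\<integral>\<^sup>+x. ennreal ((W m x)\<^sup>2) \<partial>M) \<le> (\<integral>\<^sup>+x. ennreal ((U x + D x)\<^sup>2 - 2 * (W m x * D x)) \<partial>M)"
      by (intro nn_integral_mono ennreal_leI le)
    also have "\<dots> = ennreal (LINT x|M. (U x + D x)\<^sup>2 - 2 * (W m x * D x))"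
      using sq WD order_trans[OF zero_le_power2 le] by (intro nn_integral_eq_integral) auto
    also have "(LINT x|M. (U x + D x)\<^sup>2 - 2 * (W m x * D x)) = (LINT x|M. (U x + D x)\<^sup>2)"
      using sq WD orth by (simp add: W_def)
    also have "ennreal \<dots> = (\<integral>\<^sup>+x. ennreal ((U x + D x)\<^sup>2) \<partial>M)"
      using sq by (intro nn_integral_eq_integral[symmetric]) auto
    finally show ?thesis .
  qed
  note bound = this
  have "(\<integral>\<^sup>+x. ennreal ((U x)\<^sup>2) \<partial>M) = (\<integral>\<^sup>+x. (SUP m. ennreal ((W m x)\<^sup>2)) \<partial>M)"
  proof (intro nn_integral_cong antisym)
    fix x
    have "U x = W (nat \<lceil>\<bar>U x\<bar>\<rceil>) x" by (simp add: W_def real_nat_ceiling_ge)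
    then show "ennreal ((U x)\<^sup>2) \<le> (SUP m. ennreal ((W m x)\<^sup>2))"
      by (metis SUP_upper UNIV_I)
    show "(SUP m. ennreal ((W m x)\<^sup>2)) \<le> ennreal ((U x)\<^sup>2)"
      by (intro SUP_least ennreal_leI) (auto simp: W_def)
  qed
  also have "\<dots> = (SUP m. \<integral>\<^sup>+x. ennreal ((W m x)\<^sup>2) \<partial>M)"
    by (intro nn_integral_monotone_convergence_SUP)
       (auto simp: incseq_def le_fun_def W_def intro!: ennreal_leI)
  also have "\<dots> \<le> (\<integral>\<^sup>+x. ennreal ((U x + D x)\<^sup>2) \<partial>M)"
    by (intro SUP_least bound)
  finally show ?thesis .
qed simp

section \<open>Deformed distributions of the family\<close>

lemma B_alpha_family_powr:
  assumes "B_alpha_family \<alpha> \<Lambda> S h Z w f p" "\<alpha> \<noteq> 1" "\<theta> \<in> \<Lambda>" "y \<in> S"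
  shows "p \<theta> y powr (\<alpha> - 1) = h y + Z \<theta> + w \<theta> \<bullet> f y"
proof -
  have "let b = h y + Z \<theta> + w \<theta> \<bullet> f y in (0 < b \<or> b = 0 \<and> 1 < \<alpha>) \<and> p \<theta> y = b powr (1 / (\<alpha> - 1))"
    using assms by (simp add: B_alpha_family_def)
  then show ?thesis
    using \<open>\<alpha> \<noteq> 1\<close> by (auto simp: Let_def powr_powr)
qed

text \<open>Brings the rectangle into the shape of the Laplace argument, which works on a symmetric
  cube of parameters.\<close>

lemma open_box_contains_cube:
  fixes a b :: "real^'d"
  assumes "box a b \<noteq> {}"
  obtains c e where "e > 0" "\<And>v. (\<And>i. \<bar>v $ i - c $ i\<bar> < e) \<Longrightarrow> v \<in> box a b"
proof -
  obtain c where c: "c \<in> box a b" using assms by auto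
  define e where "e = Min (range (\<lambda>i. min (c $ i - a $ i) (b $ i - c $ i)))"
  have "e > 0" using c by (auto simp: e_def mem_box_cart)
  moreover have e: "e \<le> min (c $ i - a $ i) (b $ i - c $ i)" for i
    unfolding e_def by (intro Min_le) auto
  have "v \<in> box a b" if v: "\<And>i. \<bar>v $ i - c $ i\<bar> < e" for v
  proof -
    have "a $ i < v $ i \<and> v $ i < b $ i" for i
      using v[of i] e[of i] by linarith
    then show ?thesis by (simp add: mem_box_cart)
  qed
  ultimately show ?thesis using that by blast
qed

section \<open>Measurability on powers of the support\<close>

lemma borel_measurable_vecI:
  fixes f :: "'a \<Rightarrow> real^'d"
  assumes "\<And>i. (\<lambda>x. f x $ i) \<in> borel_measurable M"
  shows "f \<in> borel_measurable M"
  using assms by (subst borel_measurable_euclidean_space) (auto simp: Basis_vec_def inner_axis)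

lemma sets_lebesgue_power:
  "sets (lebesgue_power S :: (real^'n) measure) = sets (restrict_space borel {y. \<forall>j. y $ j \<in> S})"
  by (simp add: lebesgue_power_def sets_restrict_space)

lemma space_lebesgue_power: "space (lebesgue_power S :: (real^'n) measure) = {y. \<forall>j. y $ j \<in> S}"
  by (simp add: lebesgue_power_def space_restrict_space)

lemma sets_borel_power:
  assumes "S \<in> sets borel"
  shows "{y :: real^'n. \<forall>j. y $ j \<in> S} \<in> sets borel"
proof -
  have "{y :: real^'n. \<forall>j. y $ j \<in> S} = (\<Inter>j. (\<lambda>y. y $ j) -` S)" by auto
  also have "\<dots> \<in> sets borel"
    using measurable_sets[OF borel_measurable_nth assms] by (intro sets.countable_INT') auto
  finally show ?thesis .
qed

lemma measurable_component_lebesgue_power: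
  assumes "\<phi> \<in> restrict_space borel S \<rightarrow>\<^sub>M N"
  shows "(\<lambda>y. \<phi> (y $ j)) \<in> (lebesgue_power S :: (real^'n) measure) \<rightarrow>\<^sub>M N"
proof -
  have "(\<lambda>y :: real^'n. y $ j) \<in> lebesgue_power S \<rightarrow>\<^sub>M restrict_space borel S"
    by (intro measurable_restrict_space2)
       (auto simp: space_restrict_space measurable_restrict_space1 lebesgue_power_def)
  from measurable_compose[OF this assms] show ?thesis .
qed

lemma measurable_sample_mean:
  assumes "f \<in> borel_measurable (restrict_space borel S)"
  shows "sample_mean f \<in> borel_measurable (lebesgue_power S :: (real^'n) measure)"
proof (rule borel_measurable_vecI)
  fix i
  have [measurable]: "(\<lambda>x. f x $ i) \<in> borel_measurable (restrict_space borel S)"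
    using measurable_compose[OF assms borel_measurable_nth[of i]] by simp
  note [measurable] = measurable_component_lebesgue_power[OF this]
  show "(\<lambda>y. sample_mean f y $ i) \<in> borel_measurable (lebesgue_power S :: (real^'n) measure)"
    unfolding sample_mean_def by simp
qed

text \<open>On the support the averaged power of the density is affine in \<open>f\<close>. The
  likelihood thus splits into a term free of \<theta>, a term bilinear in \<open>w \<theta>\<close>
  and the sample mean, and a term free of the data: an exponential family after
  \<open>exp\<close>.\<close>

lemma gen_likelihood_eq:
  fixes y :: "real^'n"
  assumes "B_alpha_family \<alpha> \<Lambda> S h Z w f p" "\<alpha> \<noteq> 1" "\<theta> \<in> \<Lambda>" "\<forall>j. y $ j \<in> S"
  shows "gen_likelihood \<alpha> (p \<theta>) y =
    \<alpha> / (\<alpha> - 1) * ((\<Sum>j\<in>UNIV. h (y $ j)) / CARD('n)) + \<alpha> / (\<alpha> - 1) * (w \<theta> \<bullet> sample_mean f y)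
    + ((\<alpha> * Z \<theta> - 1) / (\<alpha> - 1) - (LBINT t. p \<theta> t powr \<alpha>))"
proof -
  have "w \<theta> \<bullet> sample_mean f y = (\<Sum>j\<in>UNIV. w \<theta> \<bullet> f (y $ j)) / CARD('n)"
    unfolding sample_mean_def inner_vec_def
    by (subst sum.swap) (simp add: sum_distrib_left sum_divide_distrib mult_ac)
  moreover have "(\<Sum>j\<in>UNIV. (\<alpha> * p \<theta> (y $ j) powr (\<alpha> - 1) - 1) / (\<alpha> - 1))
      = (\<Sum>j\<in>UNIV. \<alpha> / (\<alpha> - 1) * h (y $ j) + \<alpha> / (\<alpha> - 1) * (w \<theta> \<bullet> f (y $ j)) + (\<alpha> * Z \<theta> - 1) / (\<alpha> - 1))"
    using assms by (intro sum.cong)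
      (auto simp: B_alpha_family_powr distrib_left add_divide_distrib diff_divide_distrib)
  then have "(\<Sum>j\<in>UNIV. (\<alpha> * p \<theta> (y $ j) powr (\<alpha> - 1) - 1) / (\<alpha> - 1))
      = \<alpha> / (\<alpha> - 1) * (\<Sum>j\<in>UNIV. h (y $ j)) + \<alpha> / (\<alpha> - 1) * (\<Sum>j\<in>UNIV. w \<theta> \<bullet> f (y $ j))
        + CARD('n) * ((\<alpha> * Z \<theta> - 1) / (\<alpha> - 1))"
    by (simp add: sum.distrib sum_distrib_left)
  ultimately show ?thesis
    unfolding gen_likelihood_def by (simp add: add_divide_distrib)
qed

text \<open>The family itself asks no measurability of \<open>f\<close>. Moving the parameter by
  \<open>e / 2\<close> along coordinate \<open>i\<close> stays in the cube and isolates
  \<open>f y $ i\<close> as a combination of powers of two measurable densities.\<close>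

lemma B_alpha_family_measurable_statistic:
  fixes w :: "real^'k \<Rightarrow> real^'d"
  assumes fam: "B_alpha_family \<alpha> \<Lambda> S h Z w f p" and \<alpha>: "\<alpha> \<noteq> 1"
    and e: "e > 0" and cube: "\<And>v. (\<And>i. \<bar>v $ i - c $ i\<bar> < e) \<Longrightarrow> v \<in> w ` \<Lambda>"
  shows "f \<in> borel_measurable (restrict_space borel S)"
proof (rule borel_measurable_vecI)
  fix i
  obtain \<theta>0 where \<theta>0: "\<theta>0 \<in> \<Lambda>" "w \<theta>0 = c"
    using cube[of c] e by auto
  have "c + axis i (e / 2) \<in> w ` \<Lambda>"
    using e by (intro cube) (auto simp: axis_def)
  then obtain \<theta>1 where \<theta>1: "\<theta>1 \<in> \<Lambda>" "w \<theta>1 = c + axis i (e / 2)"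
    by auto
  have pm: "p \<theta> \<in> borel_measurable borel" if "\<theta> \<in> \<Lambda>" for \<theta>
    using fam that by (simp add: B_alpha_family_def is_probability_density_def)
  note [measurable] = pm[OF \<theta>0(1)] pm[OF \<theta>1(1)]
  have eq: "f y $ i = (p \<theta>1 y powr (\<alpha> - 1) - p \<theta>0 y powr (\<alpha> - 1) - Z \<theta>1 + Z \<theta>0) / (e / 2)" if "y \<in> S" for y
    using e by (simp add: B_alpha_family_powr[OF fam \<alpha> _ that] \<theta>0 \<theta>1 inner_add_left inner_axis')
  have "(\<lambda>y. (p \<theta>1 y powr (\<alpha> - 1) - p \<theta>0 y powr (\<alpha> - 1) - Z \<theta>1 + Z \<theta>0) / (e / 2))
      \<in> borel_measurable (restrict_space borel S)"
    by (intro measurable_restrict_space1) measurable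
  then show "(\<lambda>y. f y $ i) \<in> borel_measurable (restrict_space borel S)"
    by (subst measurable_cong[OF eq]) (auto simp: space_restrict_space)
qed

lemma deformed_density_nonneg: "0 \<le> deformed_density \<alpha> S q y"
  unfolding deformed_density_def by (intro divide_nonneg_nonneg integral_nonneg_AE) auto

text \<open>The normalizing integral vanishes only if the base measure does, in which case both integrals
  are zero.\<close>

lemma deformed_integral_eq_0_iff:
  fixes D :: "real^'n \<Rightarrow> real"
  assumes L: "integrable (lebesgue_power S) (\<lambda>y :: real^'n. exp (gen_likelihood \<alpha> q y))"
    and D[measurable]: "D \<in> borel_measurable (lebesgue_power S)"
  shows "integrable (deformed_distribution \<alpha> S q) D \<longleftrightarrow>
           integrable (lebesgue_power S) (\<lambda>y. exp (gen_likelihood \<alpha> q y) * D y)" (is ?int)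
    and "(LINT y|deformed_distribution \<alpha> S q. D y) = 0 \<longleftrightarrow>
           (LINT y|lebesgue_power S. exp (gen_likelihood \<alpha> q y) * D y) = 0" (is ?zero)
proof -
  let ?M = "lebesgue_power S :: (real^'n) measure"
  define N where "N = (LINT y|?M. exp (gen_likelihood \<alpha> q y))"
  note [measurable] = borel_measurable_integrable[OF L]
  have dens[measurable]: "deformed_density \<alpha> S q \<in> borel_measurable ?M"
    unfolding deformed_density_def by measurable
  have eq: "deformed_density \<alpha> S q y *\<^sub>R D y = exp (gen_likelihood \<alpha> q y) * D y / N" for y
    by (simp add: deformed_density_def N_def)
  have i1: "integrable (deformed_distribution \<alpha> S q) D \<longleftrightarrow> integrable ?M (\<lambda>y. exp (gen_likelihood \<alpha> q y) * D y / N)"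
    unfolding deformed_distribution_def eq[symmetric]
    by (intro integrable_density) (auto simp: deformed_density_nonneg)
  have i2: "(LINT y|deformed_distribution \<alpha> S q. D y) = (LINT y|?M. exp (gen_likelihood \<alpha> q y) * D y / N)"
    unfolding deformed_distribution_def eq[symmetric]
    by (intro integral_density) (auto simp: deformed_density_nonneg)
  have *: "?int \<and> ?zero"
  proof (cases "N = 0")
    case False
    then show ?thesis by (simp add: i1 i2 divide_inverse)
  next
    \<comment> \<open>Here the left-hand integrands are \<open>0\<close> by the convention for
      division by \<open>0\<close>, the right-hand ones almost everywhere.\<close>
    case True
    then have "AE y in ?M. exp (gen_likelihood \<alpha> q y) = 0"
      using integral_nonneg_eq_0_iff_AE[OF L] by (simp add: N_def)
    then have AE: "AE y in ?M. exp (gen_likelihood \<alpha> q y) * D y = 0"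
      by eventually_elim simp
    have "integrable ?M (\<lambda>y. exp (gen_likelihood \<alpha> q y) * D y)"
      by (subst integrable_cong_AE[OF _ _ AE]) auto
    with True integral_eq_zero_AE[OF AE] show ?thesis
      by (simp add: i1 i2)
  qed
  show ?int ?zero using * by blast+
qed

section \<open>Comparison with an arbitrary unbiased competitor\<close>

theorem theorem4p3:
  fixes \<alpha> :: real
    and \<Lambda> :: "(real^'k) set"
    and S :: "real set"
    and h :: "real \<Rightarrow> real"
    and Z :: "real^'k \<Rightarrow> real"
    and w :: "real^'k \<Rightarrow> real^'d"
    and f :: "real \<Rightarrow> real^'d"
    and p :: "real^'k \<Rightarrow> real \<Rightarrow> real"
    and g :: "real^'d \<Rightarrow> real"
  assumes "\<alpha> > 0" and "\<alpha> \<noteq> 1"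
    and family: "B_alpha_family \<alpha> \<Lambda> S h Z w f p"
    and likelihood_defined: "\<And>\<theta>. \<theta> \<in> \<Lambda> \<Longrightarrow> integrable lborel (\<lambda>y. p \<theta> y powr \<alpha>)"
    and denominator_finite: "\<And>\<theta>. \<theta> \<in> \<Lambda> \<Longrightarrow>
      integrable (lebesgue_power S) (\<lambda>r :: real^'n. exp (gen_likelihood \<alpha> (p \<theta>) r))"
    and rectangle: "\<exists>a b. box a b \<noteq> {} \<and> box a b \<subseteq> w ` \<Lambda>"
    and expectation_exists: "\<And>\<theta>. \<theta> \<in> \<Lambda> \<Longrightarrow>
      integrable (deformed_distribution \<alpha> S (p \<theta>)) (\<lambda>y :: real^'n. g (sample_mean f y))"
  shows "gen_UMVUE \<alpha> \<Lambda> S p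
    (\<lambda>\<theta>. deformed_expectation \<alpha> S (p \<theta>) (\<lambda>y :: real^'n. g (sample_mean f y)))
    (\<lambda>y :: real^'n. g (sample_mean f y))"
  unfolding gen_UMVUE_def
proof (intro conjI allI impI ballI)
  let ?M = "lebesgue_power S :: (real^'n) measure"
  let ?X = "{y :: real^'n. \<forall>j. y $ j \<in> S}"
  let ?T = "sample_mean f :: real^'n \<Rightarrow> real^'d"
  let ?\<tau> = "\<lambda>\<theta>. deformed_expectation \<alpha> S (p \<theta>) (\<lambda>y :: real^'n. g (sample_mean f y))"
  show "gen_unbiased \<alpha> \<Lambda> S p ?\<tau> (\<lambda>y. g (?T y))"
    using expectation_exists by (simp add: gen_unbiased_def)
  fix T' :: "real^'n \<Rightarrow> real" and \<theta>1
  assume T': "gen_unbiased \<alpha> \<Lambda> S p ?\<tau> T'" and \<theta>1: "\<theta>1 \<in> \<Lambda>"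
  let ?P = "\<lambda>\<theta>. deformed_distribution \<alpha> S (p \<theta>) :: (real^'n) measure"
  \<comment> \<open>Deformed distributions share the measurable sets of \<open>?M\<close>, so
    integrability under one of them yields measurability on the sample space, in particular for
    \<open>g\<close> composed with the sample mean.\<close>
  have measP: "borel_measurable (?P \<theta>) = borel_measurable ?M" for \<theta>
    by (intro measurable_cong_sets) (simp_all add: deformed_distribution_def)
  obtain c :: "real^'d" and e where e: "e > 0" and cube: "\<And>v. (\<And>i. \<bar>v $ i - c $ i\<bar> < e) \<Longrightarrow> v \<in> w ` \<Lambda>"
    using rectangle open_box_contains_cube by (metis subsetD)
  have T[measurable]: "?T \<in> borel_measurable ?M"
    by (intro measurable_sample_mean B_alpha_family_measurable_statistic[OF family \<open>\<alpha> \<noteq> 1\<close> e cube])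
  have Sb: "S \<in> sets borel"
    using family \<theta>1 by (auto simp: B_alpha_family_def is_support_def)
  have gT[measurable]: "(\<lambda>y. g (?T y)) \<in> borel_measurable ?M"
    using borel_measurable_integrable[OF expectation_exists[OF \<theta>1]] by (simp add: measP)
  \<comment> \<open>An unbiased estimator of zero under every parameter.\<close>
  define D where "D y = T' y - g (?T y)" for y
  have D: "integrable (?P \<theta>) D" "(LINT y|?P \<theta>. D y) = 0" if "\<theta> \<in> \<Lambda>" for \<theta>
    using T' expectation_exists[OF that] that
    by (simp_all add: D_def[abs_def] gen_unbiased_def deformed_expectation_def)
  have Dm[measurable]: "D \<in> borel_measurable ?M"
    using borel_measurable_integrable[OF D(1)[OF \<theta>1]] by (simp add: measP)
  \<comment> \<open>Natural parameters are \<kappa> times \<open>w \<theta>\<close>; as \<kappa> is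
    nonzero, a cube of values of \<open>w\<close> gives a cube of natural parameters.\<close>
  define \<kappa> where "\<kappa> = \<alpha> / (\<alpha> - 1)"
  have \<kappa>: "\<kappa> \<noteq> 0" using \<open>\<alpha> > 0\<close> \<open>\<alpha> \<noteq> 1\<close> by (simp add: \<kappa>_def)
  define H where "H y = exp (\<kappa> * ((\<Sum>j\<in>UNIV. h (y $ j)) / CARD('n)))" for y :: "real^'n"
  \<comment> \<open>\<open>K\<close> collects the factors that depend on \<theta> alone. Being
    positive, it affects neither integrability nor the vanishing of an integral.\<close>
  have expL: "\<exists>K>0. \<forall>y\<in>space ?M. exp (gen_likelihood \<alpha> (p \<theta>) y) = K * (exp (\<kappa> * (w \<theta> \<bullet> ?T y)) * H y)"
    if "\<theta> \<in> \<Lambda>" for \<theta>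
  proof (intro exI conjI ballI)
    fix y :: "real^'n" assume "y \<in> space ?M"
    then have "\<forall>j. y $ j \<in> S" by (simp add: space_lebesgue_power)
    note L = gen_likelihood_eq[OF family \<open>\<alpha> \<noteq> 1\<close> that this]
    show "exp (gen_likelihood \<alpha> (p \<theta>) y)
        = exp ((\<alpha> * Z \<theta> - 1) / (\<alpha> - 1) - (LBINT t. p \<theta> t powr \<alpha>)) * (exp (\<kappa> * (w \<theta> \<bullet> ?T y)) * H y)"
      unfolding L exp_add H_def \<kappa>_def by (simp only: mult_ac)
  qed simp
  have canonical: "integrable ?M (\<lambda>y. exp (\<kappa> * (w \<theta> \<bullet> ?T y)) * (H y * F y)) \<longleftrightarrow> integrable (?P \<theta>) F"
    "(LINT y|?M. exp (\<kappa> * (w \<theta> \<bullet> ?T y)) * (H y * F y)) = 0 \<longleftrightarrow> (LINT y|?P \<theta>. F y) = 0"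
    if \<theta>: "\<theta> \<in> \<Lambda>" and F: "F \<in> borel_measurable ?M" for \<theta> F
  proof -
    obtain K where K: "K > 0"
        "\<And>y. y \<in> space ?M \<Longrightarrow> exp (gen_likelihood \<alpha> (p \<theta>) y) = K * (exp (\<kappa> * (w \<theta> \<bullet> ?T y)) * H y)"
      using expL[OF \<theta>] by blast
    have eq: "exp (\<kappa> * (w \<theta> \<bullet> ?T y)) * (H y * F y) = exp (gen_likelihood \<alpha> (p \<theta>) y) * F y / K" if "y \<in> space ?M" for y
      using K(1) K(2)[OF that] by simp
    show "integrable ?M (\<lambda>y. exp (\<kappa> * (w \<theta> \<bullet> ?T y)) * (H y * F y)) \<longleftrightarrow> integrable (?P \<theta>) F"
      using K(1) by (subst Bochner_Integration.integrable_cong[OF refl eq])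
        (simp_all add: divide_inverse deformed_integral_eq_0_iff(1)[OF denominator_finite[OF \<theta>] F])
    show "(LINT y|?M. exp (\<kappa> * (w \<theta> \<bullet> ?T y)) * (H y * F y)) = 0 \<longleftrightarrow> (LINT y|?P \<theta>. F y) = 0"
      using K(1) by (subst Bochner_Integration.integral_cong[OF refl eq])
        (simp_all add: divide_inverse deformed_integral_eq_0_iff(2)[OF denominator_finite[OF \<theta>] F])
  qed
  \<comment> \<open>The exponential weight at the centre \<open>c\<close> moves the cube of natural
    parameters to the origin, where the Laplace lemma expects it.\<close>
  define D0 where "D0 y = exp (\<kappa> * (c \<bullet> ?T y)) * (H y * D y)" for y
  have shift: "exp ((\<kappa> *\<^sub>R (v - c)) \<bullet> ?T y) * D0 y = exp (\<kappa> * (v \<bullet> ?T y)) * (H y * D y)" for v y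
    by (simp add: D0_def inner_diff_left algebra_simps mult_exp_exp)
  have laplace: "integrable ?M (\<lambda>y. exp (\<eta> \<bullet> ?T y) * D0 y) \<and> (LINT y|?M. exp (\<eta> \<bullet> ?T y) * D0 y) = 0"
    if \<eta>: "\<And>i. \<bar>\<eta> $ i\<bar> < e * \<bar>\<kappa>\<bar>" for \<eta> :: "real^'d"
  proof -
    \<comment> \<open>Every point of the scaled cube is the natural parameter, relative to
      \<open>c\<close>, of some member of the family, under which \<open>D\<close> has mean
      zero.\<close>
    have "c + \<eta> /\<^sub>R \<kappa> \<in> w ` \<Lambda>"
      using \<eta> \<kappa> by (intro cube) (auto simp: abs_mult field_simps)
    then obtain \<theta> where \<theta>: "\<theta> \<in> \<Lambda>" "w \<theta> = c + \<eta> /\<^sub>R \<kappa>" by auto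
    have \<eta>_eq: "\<eta> = \<kappa> *\<^sub>R (w \<theta> - c)" using \<kappa> by (simp add: \<theta>)
    show ?thesis
      unfolding \<eta>_eq shift using canonical[OF \<theta>(1) Dm] D[OF \<theta>(1)] by blast
  qed
  have D0: "integrable ?M D0"
    using laplace[of 0] e \<kappa> by simp
  have zero: "(LINT y|?M. indicator C (?T y) * D0 y) = 0" if "C \<in> sets borel" for C
    using e \<kappa> laplace by (intro integral_eq_0_if_vanishing_laplace_transform[OF T _ _ _ that, of "e * \<bar>\<kappa>\<bar>"]) auto
  have orth: "(LINT y|?P \<theta>1. (if \<bar>g (?T y) - ?\<tau> \<theta>1\<bar> \<le> real m then g (?T y) - ?\<tau> \<theta>1 else 0) * D y) = 0" (is "(LINT y|_. ?U y * D y) = 0") for m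
  proof -
    \<comment> \<open>The exponential changes the reference point from \<open>c\<close> to
      \<open>w \<theta>1\<close>, which may lie outside the cube. It depends on the sample through
      the sample mean only, so \<open>V\<close> still factors; \<open>V\<close> may be unbounded,
      but its product with \<open>D0\<close> is integrable because the truncated statistic times
      \<open>D\<close> is.\<close>
    define V where "V y = ?U y * exp ((\<kappa> *\<^sub>R (w \<theta>1 - c)) \<bullet> ?T y)" for y
    have UD: "integrable (?P \<theta>1) (\<lambda>y. ?U y * D y)"
      by (rule Bochner_Integration.integrable_bound[OF integrable_mult_right[of "real m", OF D(1)[OF \<theta>1]]])
         (auto simp: measP abs_mult intro!: mult_right_mono)
    have UDm: "(\<lambda>y. ?U y * D y) \<in> borel_measurable ?M"
      by measurable
    have VD0: "V y * D0 y = exp (\<kappa> * (w \<theta>1 \<bullet> ?T y)) * (H y * (?U y * D y))" for y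
    proof -
      have "V y * D0 y = ?U y * (exp ((\<kappa> *\<^sub>R (w \<theta>1 - c)) \<bullet> ?T y) * D0 y)"
        by (simp only: V_def mult.assoc)
      then show ?thesis unfolding shift by (simp only: mult_ac)
    qed
    have "(LINT y|?M. V y * D0 y) = 0"
    proof (rule integral_mult_factor_eq_0[OF sets_lebesgue_power sets_borel_power[OF Sb] _ D0 zero])
      show "?T \<in> borel_measurable (restrict_space borel ?X)"
        using T by (simp cong: measurable_cong_sets add: sets_lebesgue_power[symmetric])
      show "V \<in> borel_measurable ?M" unfolding V_def by measurable
      show "V y = (\<lambda>t. (if \<bar>g t - ?\<tau> \<theta>1\<bar> \<le> real m then g t - ?\<tau> \<theta>1 else 0) * exp ((\<kappa> *\<^sub>R (w \<theta>1 - c)) \<bullet> t)) (?T y)" for y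
        by (simp add: V_def)
      show "integrable ?M (\<lambda>y. V y * D0 y)"
        unfolding VD0 using canonical(1)[OF \<theta>1 UDm] UD by simp
    qed
    then show ?thesis
      unfolding VD0 using canonical(2)[OF \<theta>1 UDm] by simp
  qed
  \<comment> \<open>Both variances are centred at the same value, so the centred competitor is the
    centred statistic plus \<open>D\<close>.\<close>
  have "deformed_expectation \<alpha> S (p \<theta>1) T' = ?\<tau> \<theta>1"
    using T' \<theta>1 by (simp add: gen_unbiased_def)
  moreover have "(\<integral>\<^sup>+y. ennreal ((g (?T y) - ?\<tau> \<theta>1)\<^sup>2) \<partial>?P \<theta>1)
      \<le> (\<integral>\<^sup>+y. ennreal ((g (?T y) - ?\<tau> \<theta>1 + D y)\<^sup>2) \<partial>?P \<theta>1)"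
    by (intro nn_integral_square_le_square_add D \<theta>1 orth) (simp add: measP)
  ultimately show "deformed_variance \<alpha> S (p \<theta>1) (\<lambda>y. g (?T y)) \<le> deformed_variance \<alpha> S (p \<theta>1) T'"
    by (simp add: deformed_variance_def D_def algebra_simps)
qed

end
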